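(* Let $m,d\geq 1$ and let $f(x)\in\mathbb{Z}[x]$. (1) If $x^m-1$ divides $M_d(x)$, then $x^m-1$ divides $\sum_{e\mid d}\mu(e)f(x^{d/e})$. (2) If $x^m+1$ divides $M_d(x)$ and $f(x)$ is an odd polynomial, then $x^m+1$ divides $\sum_{e\mid d}\mu(e)f(x^{d/e})$.
   Context: $M_d(x)=\frac1d\sum_{e\mid d}\mu(e)x^{d/e}\in\mathbb{Q}[x]$ is the $d$th necklace polynomial, $\mu$ the Möbius function. Divisibility is in $\mathbb{Q}[x]$. A polynomial is odd if it has only odd-degree monomials. *)

theory Defs
  imports "HOL-Computational_Algebra.Computational_Algebra"
begin

definition moebius_mu :: "nat \<Rightarrow> int" where
  "moebius_mu n = (if squarefree n then (-1) ^ card (prime_factors n) else 0)"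

definition necklace_poly :: "nat \<Rightarrow> rat poly" where
  "necklace_poly d =
     smult (1 / of_nat d) (\<Sum>e | e dvd d. smult (of_int (moebius_mu e)) (monom 1 (d div e)))"

definition odd_poly :: "'a::zero poly \<Rightarrow> bool" where
  "odd_poly p \<longleftrightarrow> (\<forall>n. coeff p n \<noteq> 0 \<longrightarrow> odd n)"

definition necklace_sum :: "nat \<Rightarrow> int poly \<Rightarrow> rat poly" where
  "necklace_sum d f =
     (\<Sum>e | e dvd d. smult (of_int (moebius_mu e))
        (pcompose (map_poly of_int f) (monom 1 (d div e))))"

end

theory Submission
  imports Defs
begin

text \<open>
  By linearity it suffices to treat \<open>f = x^k\<close>, for which the sum is \<open>d M_d(x^k)\<close>. If
  \<open>x^m - 1\<close> divides \<open>M_d(x)\<close>, substituting \<open>x^k\<close> shows that \<open>x^(m k) - 1\<close>, and hence its divisor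
  \<open>x^m - 1\<close>, divides \<open>M_d(x^k)\<close>. For \<open>x^m + 1\<close> the same works when \<open>k\<close> is odd.
\<close>

lemma pcompose_dvd_pcompose:
  fixes p q r :: "'a :: comm_ring_1 poly"
  assumes "p dvd q"
  shows "pcompose p r dvd pcompose q r"
  using assms by (auto simp: pcompose_mult elim!: dvdE)

lemma pcompose_monom_1:
  "pcompose (monom 1 j) q = (q :: 'a :: comm_ring_1 poly) ^ j"
  by (induction j) (simp_all add: monom_Suc pcompose_pCons monom_0 pcompose_1 flip: one_pCons)

lemma dvd_power_minus_1: "(x :: 'a :: comm_ring_1) - 1 dvd x ^ k - 1"
  by (simp add: power_diff_1_eq)

text \<open>Put \<open>- x\<close> for \<open>x\<close> in \<open>dvd_power_minus_1\<close>: as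
  \<open>k\<close> is odd, both sides only change sign.\<close>

lemma dvd_odd_power_plus_1:
  assumes "odd k"
  shows "(x :: 'a :: comm_ring_1) + 1 dvd x ^ k + 1"
proof -
  have "(- x) - 1 dvd (- x) ^ k - 1"
    by (rule dvd_power_minus_1)
  also have "(- x) - 1 = - (x + 1)"
    by simp
  also have "(- x) ^ k - 1 = - (x ^ k + 1)"
    using assms by simp
  finally show ?thesis
    by (simp only: minus_dvd_iff dvd_minus_iff)
qed

lemma smult_sum_distrib:
  "smult c (\<Sum>i\<in>A. p i) = (\<Sum>i\<in>A. smult c (p i :: 'a :: comm_semiring_0 poly))"
  by (induction A rule: infinite_finite_induct) (simp_all add: smult_add_right)

text \<open>Rests on (x^(d/e))^k = (x^k)^(d/e); the factor \<open>of_nat d\<close> cancels the 1/d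
  in \<open>necklace_poly\<close>.\<close>

lemma necklace_sum_eq_sum_pcompose:
  assumes "d \<ge> 1"
  shows "necklace_sum d f =
    (\<Sum>k\<le>degree f. smult (of_int (coeff f k) * of_nat d)
      (pcompose (necklace_poly d) (monom 1 k)))"
proof -
  have f: "pcompose (map_poly of_int f) q = (\<Sum>k\<le>degree f. smult (of_int (coeff f k)) (q ^ k))"
    for q :: "rat poly"
    by (simp add: pcompose_altdef poly_altdef coeff_map_poly degree_map_poly)
  have "smult (of_nat d) (pcompose (necklace_poly d) (monom 1 k)) =
      (\<Sum>e | e dvd d. smult (of_int (moebius_mu e)) (monom 1 (d div e) ^ k))" for k
    using assms
    by (simp add: necklace_poly_def pcompose_smult pcompose_sum pcompose_monom_1
        monom_power mult.commute)
  hence "smult (of_int (coeff f k) * of_nat d) (pcompose (necklace_poly d) (monom 1 k)) =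
      smult (of_int (coeff f k))
        (\<Sum>e | e dvd d. smult (of_int (moebius_mu e)) (monom 1 (d div e) ^ k))" for k
    by (simp flip: smult_smult)
  thus ?thesis
    \<comment> \<open>Exchanging the sums over \<open>e\<close> and \<open>k\<close> groups the
      terms by the monomials of \<open>f\<close>.\<close>
    by (simp add: necklace_sum_def f smult_sum_distrib mult.commute sum.swap[of _ "{..degree f}"])
qed

text \<open>The chain is: g(x) divides g(x^k), which divides M_d(x^k). Asking this only for
  \<open>k\<close> in the support of \<open>f\<close> lets an odd \<open>f\<close> avoid even
  \<open>k\<close>, where x^m + 1 need not divide x^(mk) + 1.\<close>

lemma dvd_necklace_sum:
  assumes "d \<ge> 1" and "g dvd necklace_poly d"
    and "\<And>k. coeff f k \<noteq> 0 \<Longrightarrow> g dvd pcompose g (monom 1 k)"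
  shows "g dvd necklace_sum d f"
  unfolding necklace_sum_eq_sum_pcompose[OF assms(1)]
proof (rule dvd_sum)
  fix k
  show "g dvd smult (of_int (coeff f k) * of_nat d) (pcompose (necklace_poly d) (monom 1 k))"
  proof (cases "coeff f k = 0")
    case False
    thus ?thesis
      using assms(3) pcompose_dvd_pcompose[OF assms(2)] by (blast intro: dvd_smult dvd_trans)
  qed simp
qed

theorem theorem2p6:
  fixes m d :: nat and f :: "int poly"
  assumes "m \<ge> 1" and "d \<ge> 1"
  shows "(monom 1 m - 1 dvd necklace_poly d \<longrightarrow> monom 1 m - 1 dvd necklace_sum d f) \<and>
         (monom 1 m + 1 dvd necklace_poly d \<and> odd_poly f \<longrightarrow> monom 1 m + 1 dvd necklace_sum d f)"
proof -
  \<comment> \<open>Substituting x^k into x^m yields (x^k)^m; written as (x^m)^k it fits the two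
    power lemmas with x^m as base.\<close>
  have pow: "monom 1 k ^ m = (monom 1 m :: rat poly) ^ k" for k
    by (simp add: monom_power mult.commute)
  have minus: "monom 1 m - 1 dvd pcompose (monom 1 m - 1 :: rat poly) (monom 1 k)" for k
    by (simp add: pcompose_diff pcompose_1 pcompose_monom_1 pow dvd_power_minus_1)
  have plus: "monom 1 m + 1 dvd pcompose (monom 1 m + 1 :: rat poly) (monom 1 k)"
    if "odd k" for k
    using that by (simp add: pcompose_add pcompose_1 pcompose_monom_1 pow dvd_odd_power_plus_1)
  show ?thesis
    using dvd_necklace_sum[OF assms(2)] minus plus unfolding odd_poly_def by blast
qed

end
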